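(* Let $q$ be a complex number with $|q|<1$. Then \begin{align*} \sum_{i,j\geq 0}\frac{(-1)^jq^{i^2+3ij+3j(3j+1)/2}}{(q;q)_i(q^3;q^3)_j}=\frac{1}{(q;q^3)_\infty}, \end{align*} where the sum runs over all pairs of nonnegative integers $(i,j)$.
   Context: Notation ($q$-Pochhammer symbols): for complex $a$ and a base $p$ with $|p|<1$, $(a;p)_0:=1$, $(a;p)_n:=\prod_{k=0}^{n-1}(1-ap^k)$ for integers $n\ge 1$, and $(a;p)_\infty:=\prod_{k=0}^{\infty}(1-ap^k)$. *)

theory Defs
  imports "HOL-Analysis.Analysis"
begin

definition qpoch :: "complex \<Rightarrow> complex \<Rightarrow> nat \<Rightarrow> complex" where
  "qpoch a p n = (\<Prod>k<n. 1 - a * p ^ k)"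

(* Meaningful only for norm p < 1, where the product converges for every a. *)
definition qpoch_inf :: "complex \<Rightarrow> complex \<Rightarrow> complex" where
  "qpoch_inf a p = (\<Prod>k. 1 - a * p ^ k)"

end

theory Submission
  imports Defs
begin

text \<open>
  The exponent of \<open>q\<close> is \<open>N + (N choose 2) + (i choose 2)\<close> with \<open>N = i + 3 * j\<close>. Embed the double sum
  into the family \<open>double_sum q n\<close>, in which the factor \<open>q ^ N\<close> is replaced by \<open>t ^ N\<close>, where
  \<open>t = q ^ n\<close>; the sum in question is the case \<open>n = 1\<close>. Shifting \<open>i\<close> and \<open>j\<close>
  shows that the family satisfies
  \<open>X n = (1 + q ^ n) * X (n + 1) - q ^ (2 * n + 1) * X (n + 2)\<close> for \<open>n \<ge> 1\<close>
  (\<open>double_sum_three_term\<close>), and dominated convergence shows that it tends to 1. These two properties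
  determine the family (\<open>zero_of_three_term_recurrence\<close>), so it suffices to find another solution that
  can be evaluated at \<open>n = 1\<close>.

  Such a solution is \<open>single_sum q n\<close>, the sum over \<open>m\<close> of
  \<open>(-1) ^ m * q ^ (3 * (m choose 2)) * t ^ (2 * m) / (q; q)_m * K (t * q ^ m)\<close>, where \<open>K t\<close> is the
  quotient of \<open>(t ^ 3; q ^ 3)\<close> by \<open>(t; q)\<close>, both infinite products. It arises as follows. Let \<open>\<omega>\<close> be a primitive cube
  root of unity. Since \<open>(z ^ 3; q ^ 3) = (z; q) * (\<omega> * z; q) * (\<omega>\<^sup>2 * z; q)\<close>, the double sum can be
  rewritten as a sum over \<open>a\<close> and \<open>b\<close> of
  \<open>(-1) ^ (a + b) * q ^ ((a + b) choose 2) * (\<omega> * t) ^ a * (\<omega>\<^sup>2 * t) ^ b / ((q; q)_a * (q; q)_b)\<close>.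
  This is a case of a confluent basic hypergeometric series, and a limit of Watson's transformation
  turns it into the single sum. The proof below replaces the transformation by the
  recurrence: \<open>single_sum_three_term\<close> and \<open>single_sum_tendsto_1\<close> identify the two families without
  mentioning \<open>\<omega>\<close>.

  At \<open>t = q\<close> the factors \<open>K (q ^ (m + 1))\<close> equal \<open>K q * (q; q)_m / (q ^ 3; q ^ 3)_m\<close>, and the single
  sum collapses to \<open>K q\<close> times Euler's series for the infinite product \<open>(q\<^sup>2; q ^ 3)\<close>
  (\<open>single_sum_1\<close>). Splitting \<open>(q; q)\<close> into residue classes modulo 3 leaves the stated product.
\<close>

section \<open>Finite and infinite q-Pochhammer symbols\<close>

lemma qpoch_0 [simp]: "qpoch a p 0 = 1"
  by (simp add: qpoch_def)

lemma qpoch_Suc: "qpoch a p (Suc n) = qpoch a p n * (1 - a * p ^ n)"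
  by (simp add: qpoch_def)

lemma qpoch_add: "qpoch a p (m + n) = qpoch a p m * qpoch (a * p ^ m) p n"
  by (induction n) (simp_all add: qpoch_Suc power_add mult.assoc)

lemma one_minus_mult_power_nonzero:
  fixes a p :: complex
  assumes "norm a < 1" "norm p < 1"
  shows "1 - a * p ^ n \<noteq> 0"
proof -
  have "norm (a * p ^ n) \<le> norm a * 1"
    unfolding norm_mult norm_power using assms by (intro mult_left_mono power_le_one) auto
  then show ?thesis using assms by auto
qed

lemma qpoch_nonzero: "norm a < 1 \<Longrightarrow> norm p < 1 \<Longrightarrow> qpoch a p n \<noteq> 0"
  using one_minus_mult_power_nonzero by (simp add: qpoch_def)

lemma norm_cube_less_1:
  fixes q :: complex
  shows "norm q < 1 \<Longrightarrow> norm (q ^ 3) < 1"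
  by (simp add: norm_power power_less_one_iff)

lemma convergent_prod_qpoch:
  fixes a p :: complex
  assumes "norm p < 1"
  shows "convergent_prod (\<lambda>k. 1 - a * p ^ k)"
proof (rule abs_convergent_prod_imp_convergent_prod[OF summable_imp_abs_convergent_prod])
  show "summable (\<lambda>k. norm (1 - a * p ^ k - 1))"
    using assms by (simp add: norm_mult norm_power summable_mult summable_geometric)
qed

lemma qpoch_tendsto:
  assumes "norm p < 1"
  shows "qpoch a p \<longlonglongrightarrow> qpoch_inf a p"
proof -
  have "(\<lambda>n. qpoch a p (Suc n)) \<longlonglongrightarrow> qpoch_inf a p"
    using convergent_prod_LIMSEQ[OF convergent_prod_qpoch[OF assms]]
    by (simp add: qpoch_def qpoch_inf_def lessThan_Suc_atMost)
  then show ?thesis by (rule LIMSEQ_imp_Suc)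
qed

lemma qpoch_inf_nonzero: "norm a < 1 \<Longrightarrow> norm p < 1 \<Longrightarrow> qpoch_inf a p \<noteq> 0"
  unfolding qpoch_inf_def
  by (intro prodinf_nonzero convergent_prod_qpoch one_minus_mult_power_nonzero)

lemma qpoch_inf_split:
  assumes "norm p < 1"
  shows "qpoch_inf a p = qpoch a p n * qpoch_inf (a * p ^ n) p"
proof (rule LIMSEQ_unique)
  show "(\<lambda>m. qpoch a p (m + n)) \<longlonglongrightarrow> qpoch_inf a p"
    using qpoch_tendsto[OF assms] by (rule LIMSEQ_ignore_initial_segment)
  show "(\<lambda>m. qpoch a p (m + n)) \<longlonglongrightarrow> qpoch a p n * qpoch_inf (a * p ^ n) p"
    unfolding add.commute[of _ n] qpoch_add by (intro tendsto_intros qpoch_tendsto assms)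
qed

lemma qpoch_inf_tail_tendsto_1:
  assumes "norm a < 1" "norm p < 1"
  shows "(\<lambda>n. qpoch_inf (a * p ^ n) p) \<longlonglongrightarrow> 1"
proof -
  have "(\<lambda>n. qpoch_inf a p / qpoch a p n) \<longlonglongrightarrow> qpoch_inf a p / qpoch_inf a p"
    by (intro tendsto_intros qpoch_tendsto qpoch_inf_nonzero assms)
  moreover have "qpoch_inf a p / qpoch a p n = qpoch_inf (a * p ^ n) p" for n
    using qpoch_inf_split[of p a n] qpoch_nonzero[of a p n] assms by simp
  ultimately show ?thesis using qpoch_inf_nonzero[of a p] assms by simp
qed

text \<open>
  The denominators \<open>qpoch a p n\<close> converge to a nonzero limit, so they stay away from zero.
\<close>

lemma inverse_qpoch_bounded:
  assumes "norm a < 1" "norm p < 1"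
  obtains C where "C > 0" "\<And>n. norm (1 / qpoch a p n) \<le> C"
proof -
  have "(\<lambda>n. 1 / qpoch a p n) \<longlonglongrightarrow> 1 / qpoch_inf a p"
    by (intro tendsto_intros qpoch_tendsto qpoch_inf_nonzero assms)
  then have "Bseq (\<lambda>n. 1 / qpoch a p n)"
    using convergentI convergent_imp_Bseq by blast
  then show ?thesis using that unfolding Bseq_def by blast
qed

text \<open>
  Sorting the exponents of \<open>p\<close> by their residue modulo 3 already proves the identity for the first
  \<open>3 * n\<close> factors.
\<close>

lemma qpoch_inf_trisect:
  assumes "norm p < 1"
  shows "qpoch_inf a p = qpoch_inf a (p^3) * qpoch_inf (a*p) (p^3) * qpoch_inf (a*p^2) (p^3)"
proof (rule LIMSEQ_unique)
  note p3 = norm_cube_less_1[OF assms]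
  have "strict_mono (\<lambda>n::nat. 3 * n)" by (simp add: strict_mono_def)
  from LIMSEQ_subseq_LIMSEQ[OF qpoch_tendsto[OF assms] this]
  show "(\<lambda>n. qpoch a p (3 * n)) \<longlonglongrightarrow> qpoch_inf a p" by (simp add: o_def)
  have "qpoch a p (3 * n) = qpoch a (p^3) n * qpoch (a*p) (p^3) n * qpoch (a*p^2) (p^3) n" for n
  proof (induction n)
    case (Suc n)
    have "3 * Suc n = Suc (Suc (Suc (3 * n)))" by simp
    then show ?case
      by (simp only: Suc.IH qpoch_Suc)
        (simp add: power_mult[symmetric] power2_eq_square mult_ac)
  qed simp
  then show "(\<lambda>n. qpoch a p (3 * n)) \<longlonglongrightarrow>
      qpoch_inf a (p^3) * qpoch_inf (a*p) (p^3) * qpoch_inf (a*p^2) (p^3)"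
    by (simp only:) (intro tendsto_intros qpoch_tendsto p3)
qed

section \<open>Triangular numbers as exponents\<close>

lemma zero_choose_2 [simp]: "(0::nat) choose 2 = 0"
  by (simp add: numeral_2_eq_2)

lemma choose_2_Suc: "Suc n choose 2 = n + (n choose 2)"
  by (simp add: numeral_2_eq_2)

lemma choose_2_add: "(m + n) choose 2 = (m choose 2) + (n choose 2) + m * n"
  by (induction m) (simp_all add: choose_2_Suc)

text \<open>
  The quadratic form is a function of \<open>N = i + 3 * j\<close> plus a function of \<open>i\<close>. This lets a shift of
  \<open>i\<close> or \<open>j\<close> act on the power of \<open>q\<close> almost through \<open>N\<close> alone.
\<close>

lemma exponent_eq:
  "i^2 + 3*i*j + (3*j*(3*j+1)) div 2 = (i + 3*j) + ((i + 3*j) choose 2) + (i choose 2)"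
proof -
  have "i^2 = i + 2 * (i choose 2)"
    by (induction i) (simp_all add: choose_2_Suc power2_eq_square)
  moreover have "(3*j*(3*j+1)) div 2 = 3*j + (3*j choose 2)"
    using choose_two[of "Suc (3*j)"] by (simp add: choose_2_Suc mult.commute)
  ultimately show ?thesis
    by (simp add: choose_2_add)
qed

section \<open>Infinite sums\<close>

lemma has_sum_of_reindexed:
  assumes "inj h" "\<And>x. x \<notin> range h \<Longrightarrow> f x = 0" "((\<lambda>x. f (h x)) has_sum S) UNIV"
  shows "(f has_sum S) UNIV"
proof -
  have "(f has_sum S) (range h)"
    using assms has_sum_reindex[of h UNIV f S] by (simp add: o_def)
  also have "?this \<longleftrightarrow> ?thesis"
    by (rule has_sum_cong_neutral) (use assms in auto)
  finally show ?thesis .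
qed

lemma has_sum_shift_nat:
  fixes f :: "nat \<Rightarrow> 'a :: {comm_monoid_add, topological_space}"
  assumes "f 0 = 0" "((\<lambda>m. f (Suc m)) has_sum S) UNIV"
  shows "(f has_sum S) UNIV"
proof (rule has_sum_of_reindexed[where h = Suc])
  show "((\<lambda>m. f (Suc m)) has_sum S) UNIV" by fact
  fix x :: nat assume "x \<notin> range Suc"
  then show "f x = 0" using assms(1) by (cases x) auto
qed simp

lemma has_sum_minus:
  fixes f g :: "'a \<Rightarrow> complex"
  assumes "(f has_sum S) A" "(g has_sum T) A"
  shows "((\<lambda>x. f x - g x) has_sum (S - T)) A"
  using has_sum_add[OF assms(1), of "\<lambda>x. - g x" "- T"] assms(2) by (simp add: has_sum_uminus)

text \<open>
  All series below are power series with constant term 1 in \<open>t = q ^ n\<close> (or \<open>x * p ^ n\<close>), possibly with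
  a further factor tending to 1. Continuity at \<open>t = 0\<close> is therefore dominated convergence in which
  only one index survives.
\<close>

lemma infsum_tendsto_1_of_dominated:
  fixes f :: "nat \<Rightarrow> 'a \<Rightarrow> complex"
  assumes bound: "\<And>n x. norm (f n x) \<le> M x" "M summable_on UNIV"
    and lim: "(\<lambda>n. f n a) \<longlonglongrightarrow> 1" "\<And>x. x \<noteq> a \<Longrightarrow> (\<lambda>n. f n x) \<longlonglongrightarrow> 0"
  shows "(\<lambda>n. infsum (f n) UNIV) \<longlonglongrightarrow> 1"
proof (rule swap_uniform_limit')
  define g :: "'a \<Rightarrow> complex" where "g x = (if x = a then 1 else 0)" for x
  show "uniform_limit UNIV (\<lambda>X n. \<Sum>x\<in>X. f n x) (\<lambda>n. infsum (f n) UNIV)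
      (finite_subsets_at_top UNIV)"
    by (rule Weierstrass_m_test_general) (use bound in auto)
  have "(\<lambda>n. f n x) \<longlonglongrightarrow> g x" for x
    using lim by (cases "x = a") (auto simp: g_def)
  then show "\<forall>\<^sub>F X in finite_subsets_at_top UNIV. (\<lambda>n. \<Sum>x\<in>X. f n x) \<longlonglongrightarrow> (\<Sum>x\<in>X. g x)"
    by (intro always_eventually allI tendsto_sum)
  have "(g has_sum 1) UNIV"
    by (rule has_sum_finite_neutralI[of "{a}"]) (auto simp: g_def)
  then show "((\<lambda>X. \<Sum>x\<in>X. g x) \<longlongrightarrow> 1) (finite_subsets_at_top UNIV)"
    by (simp add: has_sum_def)
qed simp_all

lemma has_sum_infsum_of_dominated:
  fixes f :: "'a \<Rightarrow> complex"
  assumes "\<And>x. norm (f x) \<le> M x" "M summable_on A"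
  shows "(f has_sum infsum f A) A"
proof -
  have "(\<lambda>x. norm (f x)) summable_on A"
    by (rule summable_on_comparison_test[OF assms(2)]) (use assms(1) in auto)
  then show ?thesis
    using abs_summable_summable has_sum_infsum by blast
qed

lemma geometric_summable_on:
  fixes r :: real
  assumes "0 \<le> r" "r < 1"
  shows "(\<lambda>n. C * r ^ n) summable_on UNIV"
  using assms
  by (intro summable_on_cmult_right summable_nonneg_imp_summable_on summable_geometric) auto

lemma geometric_summable_on_pairs:
  fixes r :: real
  assumes "0 \<le> r" "r < 1" "0 \<le> C"
  shows "(\<lambda>(i, j). C * r ^ (i + j)) summable_on (UNIV :: (nat \<times> nat) set)"
proof -
  have geometric: "((\<lambda>j. r ^ j) has_sum (1 / (1 - r))) UNIV"
    using assms by (intro sums_nonneg_imp_has_sum geometric_sums) auto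
  have "(\<lambda>(i, j). C * r ^ (i + j)) summable_on (UNIV \<times> UNIV :: (nat \<times> nat) set)"
  proof (rule summable_on_SigmaI)
    show "((\<lambda>j. case (i, j) of (i, j) \<Rightarrow> C * r ^ (i + j)) has_sum (C / (1 - r)) * r ^ i) UNIV" for i
      using has_sum_cmult_right[OF geometric, of "C * r ^ i"] by (simp add: power_add mult_ac)
    show "(\<lambda>i. (C / (1 - r)) * r ^ i) summable_on UNIV"
      by (intro geometric_summable_on assms)
  qed (use assms in auto)
  then show ?thesis by simp
qed

section \<open>Sequences determined by their recurrence and their limit\<close>

lemma power_tendsto_0_mult:
  fixes q :: complex
  assumes "norm q < 1" "k > 0"
  shows "(\<lambda>n. q ^ (Suc n * k)) \<longlonglongrightarrow> 0"
proof -
  have "norm (q ^ k) < 1"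
    using assms by (simp add: norm_power power_less_one_iff)
  then have "(\<lambda>n. (q ^ k) ^ n) \<longlonglongrightarrow> 0" by (rule LIMSEQ_power_zero)
  then have "(\<lambda>n. (q ^ k) ^ Suc n) \<longlonglongrightarrow> 0" by (rule LIMSEQ_Suc)
  then show ?thesis by (simp only: power_mult[symmetric] mult.commute)
qed

text \<open>
  Iteration gives \<open>\<bar>X n\<bar> \<le> \<bar>q\<bar> ^ k * \<bar>X (n + k)\<bar>\<close>, and \<open>X\<close> is bounded.
\<close>

lemma zero_of_damped_recurrence:
  fixes q :: complex
  assumes "norm q < 1" "\<And>n. n \<ge> 1 \<Longrightarrow> norm (X n) \<le> norm q * norm (X (Suc n))" "X \<longlonglongrightarrow> L"
    and "n \<ge> 1"
  shows "X n = (0::complex)"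
proof -
  have *: "norm (X n) \<le> norm q ^ k * norm (X (n + k))" for k
  proof (induction k)
    case (Suc k)
    have "norm q ^ k * norm (X (n + k)) \<le> norm q ^ k * (norm q * norm (X (Suc (n + k))))"
      using assms by (intro mult_left_mono) auto
    with Suc show ?case by (simp add: mult_ac)
  qed simp
  have "(\<lambda>k. norm q ^ k * norm (X (k + n))) \<longlonglongrightarrow> 0 * norm L"
    using assms by (intro tendsto_intros LIMSEQ_power_zero LIMSEQ_ignore_initial_segment) auto
  then have "norm (X n) \<le> 0"
    using * by (intro LIMSEQ_le_const) (auto simp: add.commute)
  then show ?thesis by simp
qed

text \<open>
  The double sum and the single sum are both shown to satisfy the recurrence
  \<open>X n = (1 + q ^ n) * X (n + 1) - q ^ (2 * n + 1) * X (n + 2)\<close> by proving that the difference of the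
  two sides is damped; this supplies the limit needed there.
\<close>

lemma three_term_defect_tendsto_0:
  fixes q :: complex
  assumes q: "norm q < 1" and lim: "X \<longlonglongrightarrow> 1"
  shows "(\<lambda>n. X n - (1 + q ^ n) * X (n+1) + q ^ (2*n+1) * X (n+2)) \<longlonglongrightarrow> 0"
proof -
  have "(\<lambda>n. X n - (1 + q ^ n) * X (n+1) + q ^ (2*n+1) * X (n+2)) \<longlonglongrightarrow> 1 - (1 + 0) * 1 + 0 * 1"
  proof (intro tendsto_intros lim LIMSEQ_ignore_initial_segment LIMSEQ_power_zero q)
    show "(\<lambda>n. q ^ (2*n+1)) \<longlonglongrightarrow> 0"
      using LIMSEQ_subseq_LIMSEQ[OF LIMSEQ_power_zero[OF q], of "\<lambda>n. 2*n+1"]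
      by (simp add: o_def strict_mono_def)
  qed
  then show ?thesis by simp
qed

text \<open>
  A second-order recurrence usually needs two initial values; here the limit at infinity replaces
  both. Let \<open>M n\<close> be the larger of the norms of two consecutive terms. The recurrence gives
  \<open>M n \<le> (1 + 2 * \<bar>q\<bar> ^ n) * M (n + 1)\<close>, since \<open>\<bar>q\<bar> ^ (2 * n + 1) \<le> \<bar>q\<bar> ^ n\<close>. Hence \<open>M n\<close> times the
  partial product \<open>P n\<close> of the factors \<open>1 + 2 * \<bar>q\<bar> ^ k\<close> is nonnegative and nondecreasing. The product
  converges, so this quantity tends to 0 and must vanish.
\<close>

lemma zero_of_three_term_recurrence:
  fixes q :: complex
  assumes q: "norm q < 1"
    and rec: "\<And>n. n \<ge> 1 \<Longrightarrow> d n = (1 + q ^ n) * d (n + 1) - q ^ (2*n+1) * d (n + 2)"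
    and lim: "d \<longlonglongrightarrow> 0" and "n \<ge> 1"
  shows "d n = (0::complex)"
proof -
  define M where "M n = max (norm (d n)) (norm (d (Suc n)))" for n
  define P where "P n = (\<Prod>k<n. 1 + 2 * norm q ^ k)" for n
  have M_nonneg: "M n \<ge> 0" for n
    unfolding M_def by (rule order.trans[OF norm_ge_zero max.cobounded1])
  have P1: "P n \<ge> 1" for n
    unfolding P_def by (intro prod_ge_1) auto
  have M_step: "M n \<le> (1 + 2 * norm q ^ n) * M (Suc n)" if "n \<ge> 1" for n
  proof -
    have le: "norm q ^ (2*n+1) \<le> norm q ^ n"
      using q by (intro power_decreasing) auto
    have "norm (d n) \<le> norm (1 + q ^ n) * norm (d (n+1)) + norm q ^ (2*n+1) * norm (d (n+2))"
      unfolding rec[OF that] by (rule order.trans[OF norm_triangle_ineq4]) (simp add: norm_mult norm_power)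
    also have "\<dots> \<le> (1 + norm q ^ n) * M (Suc n) + norm q ^ n * M (Suc n)"
      using le by (intro add_mono mult_mono order.trans[OF norm_triangle_ineq])
        (auto simp: M_nonneg norm_power, auto simp: M_def)
    finally have "norm (d n) \<le> (1 + 2 * norm q ^ n) * M (Suc n)" by (simp add: algebra_simps)
    moreover have "norm (d (Suc n)) \<le> 1 * M (Suc n)" by (simp add: M_def)
    moreover have "1 * M (Suc n) \<le> (1 + 2 * norm q ^ n) * M (Suc n)"
      by (intro mult_right_mono M_nonneg) auto
    ultimately show ?thesis by (simp add: M_def)
  qed
  have "P (Suc n) * M (Suc n) \<ge> P n * M n" if "n \<ge> 1" for n
    using mult_left_mono[OF M_step[OF that], of "P n"] P1[of n] by (simp add: P_def mult_ac)
  then have mono: "incseq (\<lambda>k. P (k + n) * M (k + n))"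
    using \<open>n \<ge> 1\<close> by (intro incseq_SucI) auto
  have "convergent P"
  proof -
    have "summable (\<lambda>k. 2 * norm q ^ k)"
      using q by (intro summable_mult summable_geometric) auto
    then have "abs_convergent_prod (\<lambda>k. 1 + 2 * norm q ^ k)"
      by (intro summable_imp_abs_convergent_prod) simp
    then have "convergent_prod (\<lambda>k. 1 + 2 * norm q ^ k)"
      by (rule abs_convergent_prod_imp_convergent_prod)
    from convergent_prod_LIMSEQ[OF this] have "convergent (\<lambda>n. P (Suc n))"
      unfolding P_def lessThan_Suc_atMost by (rule convergentI)
    then show ?thesis by (simp add: convergent_Suc_iff)
  qed
  then obtain L where "P \<longlonglongrightarrow> L" by (auto simp: convergent_def)
  moreover have "M \<longlonglongrightarrow> 0"
    unfolding M_def using tendsto_max[OF tendsto_norm[OF lim] tendsto_norm[OF LIMSEQ_Suc[OF lim]]]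
    by simp
  ultimately have "(\<lambda>n. P n * M n) \<longlonglongrightarrow> L * 0" by (rule tendsto_mult)
  then have "(\<lambda>k. P (k + n) * M (k + n)) \<longlonglongrightarrow> 0"
    using LIMSEQ_ignore_initial_segment[of "\<lambda>n. P n * M n" 0 n] by simp
  from incseq_le[OF mono this, of 0] have "P n * M n \<le> 0" by simp
  with P1[of n] have "M n \<le> 0"
    by (smt (verit) mult_pos_pos)
  then show ?thesis by (simp add: M_def)
qed

section \<open>Euler's expansion of the infinite q-Pochhammer symbol\<close>

text \<open>
  The series \<open>F n\<close> in the argument \<open>x * p ^ n\<close> satisfies \<open>F n = (1 - x * p ^ n) * F (n + 1)\<close>, because
  multiplying its \<open>m\<close>-th term by \<open>1 - p ^ m\<close> cancels the last factor of the denominator. So \<open>F 0\<close> is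
  the \<open>n\<close>-th partial product times \<open>F n\<close>, and \<open>F n\<close> tends to 1.
\<close>

lemma euler_qpoch_inf:
  fixes x p :: complex
  assumes x: "norm x < 1" and p: "norm p < 1"
  shows "((\<lambda>m. (-1) ^ m * p ^ (m choose 2) * x ^ m / qpoch p p m) has_sum qpoch_inf x p) UNIV"
proof -
  define e where "e n m = (-1) ^ m * p ^ (m choose 2) * (x * p ^ n) ^ m / qpoch p p m" for n m
  define F where "F n = infsum (e n) UNIV" for n
  obtain C where C: "C > 0" "\<And>n. norm (1 / qpoch p p n) \<le> C"
    using inverse_qpoch_bounded[OF p p] by blast
  have bound: "norm (e n m) \<le> C * norm x ^ m" for n m
  proof -
    have "norm (e n m) = norm p ^ ((m choose 2) + n * m) * norm x ^ m * norm (1 / qpoch p p m)"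
      by (simp add: e_def norm_mult norm_divide norm_power power_mult_distrib power_mult power_add)
    also have "\<dots> \<le> 1 * norm x ^ m * C"
      using p C by (intro mult_mono power_le_one) auto
    finally show ?thesis by (simp add: mult_ac)
  qed
  have dom: "(\<lambda>m. C * norm x ^ m) summable_on UNIV"
    using x by (intro geometric_summable_on) auto
  have e_sum: "(e n has_sum F n) UNIV" for n
    unfolding F_def by (rule has_sum_infsum_of_dominated[OF bound dom])
  have F_step: "F n = (1 - x * p ^ n) * F (Suc n)" for n
  proof -
    have "((\<lambda>m. e n m - e (Suc n) m) has_sum (- (x * p ^ n) * F (Suc n))) UNIV"
    proof (rule has_sum_shift_nat)
      have "e n (Suc m) - e (Suc n) (Suc m) = - (x * p ^ n) * e (Suc n) m" for m
      proof -
        have "1 - p * p ^ m \<noteq> 0" "qpoch p p m \<noteq> 0"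
          using one_minus_mult_power_nonzero[OF p p] qpoch_nonzero[OF p p] by auto
        then show ?thesis
          by (simp add: e_def qpoch_Suc choose_2_Suc divide_simps power_mult_distrib power_add)
            (simp add: algebra_simps)
      qed
      then show "((\<lambda>m. e n (Suc m) - e (Suc n) (Suc m)) has_sum (- (x * p ^ n) * F (Suc n))) UNIV"
        by (simp only:) (intro has_sum_cmult_right e_sum)
    qed (simp add: e_def)
    moreover have "((\<lambda>m. e n m - e (Suc n) m) has_sum (F n - F (Suc n))) UNIV"
      by (intro has_sum_minus e_sum)
    ultimately have "F n - F (Suc n) = - (x * p ^ n) * F (Suc n)"
      by (rule has_sum_unique[rotated])
    then show ?thesis by (simp add: algebra_simps)
  qed
  have F_0: "F 0 = qpoch x p n * F n" for n
  proof (induction n)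
    case (Suc n)
    then show ?case using F_step[of n] by (simp add: qpoch_Suc)
  qed simp
  have "(\<lambda>n. F (Suc n)) \<longlonglongrightarrow> 1"
    unfolding F_def
  proof (rule infsum_tendsto_1_of_dominated[OF bound dom])
    fix m :: nat assume "m \<noteq> 0"
    then have "(\<lambda>n. p ^ (Suc n * m) * ((-1) ^ m * p ^ (m choose 2) * x ^ m / qpoch p p m)) \<longlonglongrightarrow>
        0 * ((-1) ^ m * p ^ (m choose 2) * x ^ m / qpoch p p m)"
      by (intro tendsto_intros power_tendsto_0_mult p) auto
    moreover have "p ^ (Suc n * m) * ((-1) ^ m * p ^ (m choose 2) * x ^ m / qpoch p p m) = e (Suc n) m" for n
      unfolding e_def power_mult_distrib by (simp only: power_mult) simp
    ultimately show "(\<lambda>n. e (Suc n) m) \<longlonglongrightarrow> 0" by simp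
  qed (simp add: e_def)
  then have "F \<longlonglongrightarrow> 1" by (rule LIMSEQ_imp_Suc)
  then have "(\<lambda>n. qpoch x p n * F n) \<longlonglongrightarrow> qpoch_inf x p * 1"
    by (intro tendsto_mult qpoch_tendsto p)
  then have "F 0 = qpoch_inf x p"
    unfolding F_0[symmetric] by (simp add: LIMSEQ_const_iff)
  with e_sum[of 0] show ?thesis by (simp add: e_def[abs_def])
qed

section \<open>The double sum as a function of \<open>t = q ^ n\<close>\<close>

text \<open>
  By \<open>exponent_eq\<close> the case \<open>n = 1\<close> is the summand in question. Its factor \<open>q ^ (i + 3 * j)\<close> becomes
  \<open>t ^ (i + 3 * j)\<close> with \<open>t = q ^ n\<close>, while the remaining power of \<open>q\<close> keeps its triangular exponents.
\<close>

definition double_term :: "complex \<Rightarrow> nat \<Rightarrow> nat \<times> nat \<Rightarrow> complex" where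
  "double_term q n = (\<lambda>(i, j). (-1) ^ j * q ^ (n * (i + 3*j) + ((i + 3*j) choose 2) + (i choose 2))
     / (qpoch q q i * qpoch (q^3) (q^3) j))"

definition double_sum :: "complex \<Rightarrow> nat \<Rightarrow> complex" where
  "double_sum q n = infsum (double_term q n) UNIV"

lemma double_term_dominated:
  assumes q: "norm q < 1"
  obtains M where "M summable_on UNIV" "\<And>n x. n \<ge> 1 \<Longrightarrow> norm (double_term q n x) \<le> M x"
proof -
  note q3 = norm_cube_less_1[OF q]
  obtain C where C: "C > 0" "\<And>i. norm (1 / qpoch q q i) \<le> C"
    using inverse_qpoch_bounded[OF q q] by blast
  obtain C' where C': "C' > 0" "\<And>j. norm (1 / qpoch (q^3) (q^3) j) \<le> C'"
    using inverse_qpoch_bounded[OF q3 q3] by blast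
  show ?thesis
  proof (rule that)
    show "(\<lambda>(i, j). (C * C') * norm q ^ (i + j)) summable_on UNIV"
      using q C C' by (intro geometric_summable_on_pairs) auto
    fix n :: nat and x :: "nat \<times> nat" assume "n \<ge> 1"
    obtain i j where x: "x = (i, j)" by (cases x)
    define k where "k = n * (i + 3*j) + ((i + 3*j) choose 2) + (i choose 2)"
    have "1 * (i + 3 * j) \<le> n * (i + 3 * j)"
      using \<open>n \<ge> 1\<close> by (rule mult_right_mono) simp
    then have "i + 3 * j \<le> n * (i + 3 * j)" by simp
    then have "i + j \<le> k" unfolding k_def by linarith
    then have "norm q ^ k \<le> norm q ^ (i + j)"
      using q by (intro power_decreasing) auto
    have "norm (double_term q n x) =
        norm (1 / qpoch q q i) * norm (1 / qpoch (q^3) (q^3) j) * norm q ^ k"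
      by (simp add: double_term_def x k_def norm_mult norm_divide norm_power)
    also have "\<dots> \<le> C * C' * norm q ^ (i + j)"
      using \<open>norm q ^ k \<le> _\<close> C C' by (intro mult_mono) auto
    finally show "norm (double_term q n x) \<le> (case x of (i, j) \<Rightarrow> (C * C') * norm q ^ (i + j))"
      by (simp add: x)
  qed
qed

lemma double_term_has_sum:
  assumes "norm q < 1" "n \<ge> 1"
  shows "(double_term q n has_sum double_sum q n) UNIV"
proof -
  obtain M where "M summable_on UNIV" "\<And>x. norm (double_term q n x) \<le> M x"
    using double_term_dominated[OF assms(1)] assms(2) by metis
  then show ?thesis
    unfolding double_sum_def by (intro has_sum_infsum_of_dominated)
qed

lemma double_sum_tendsto_1:
  assumes q: "norm q < 1"
  shows "double_sum q \<longlonglongrightarrow> 1"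
proof -
  obtain M where M: "M summable_on UNIV" "\<And>n x. n \<ge> 1 \<Longrightarrow> norm (double_term q n x) \<le> M x"
    using double_term_dominated[OF q] by blast
  have "(\<lambda>n. infsum (double_term q (Suc n)) UNIV) \<longlonglongrightarrow> 1"
  proof (rule infsum_tendsto_1_of_dominated[where a = "(0, 0)"])
    show "norm (double_term q (Suc n) x) \<le> M x" for n x
      by (rule M(2)) simp
    fix x :: "nat \<times> nat" assume "x \<noteq> (0, 0)"
    moreover obtain i j where x: "x = (i, j)" by (cases x)
    ultimately have pos: "i + 3 * j > 0" by auto
    define c where "c = double_term q 0 x"
    have "(\<lambda>n. q ^ (Suc n * (i + 3*j)) * c) \<longlonglongrightarrow> 0 * c"
      by (intro tendsto_mult power_tendsto_0_mult q pos tendsto_const)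
    moreover have "q ^ (Suc n * (i + 3*j)) * c = double_term q (Suc n) x" for n
      unfolding c_def double_term_def x by (simp add: power_add mult_ac)
    ultimately show "(\<lambda>n. double_term q (Suc n) x) \<longlonglongrightarrow> 0" by simp
  qed (use M in \<open>simp_all add: double_term_def\<close>)
  then show ?thesis
    unfolding double_sum_def[symmetric] by (rule LIMSEQ_imp_Suc)
qed

text \<open>
  Write \<open>N = i + 3 * j\<close>. Passing from \<open>n\<close> to \<open>n + 1\<close> multiplies a term by \<open>q ^ N\<close>, and
  \<open>1 - q ^ N = (1 - q ^ (3 * j)) + q ^ (3 * j) * (1 - q ^ i)\<close>. Each summand cancels the last factor of
  one of the two denominators and vanishes when that index is 0, so shifting the index down turns the
  two parts into multiples of the sums at \<open>n + 3\<close> and \<open>n + 2\<close>.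
\<close>

lemma double_sum_four_term:
  assumes q: "norm q < 1" and n: "n \<ge> 1"
  shows "double_sum q n - double_sum q (n+1)
    = q ^ n * double_sum q (n+2) - q ^ (3*n+3) * double_sum q (n+3)"
proof -
  note q3 = norm_cube_less_1[OF q]
  define f1 where "f1 = (\<lambda>(i, j). (1 - q ^ (3*j)) * double_term q n (i, j))"
  define f2 where "f2 = (\<lambda>(i, j). q ^ (3*j) * (1 - q ^ i) * double_term q n (i, j))"
  have "(f1 has_sum (- (q ^ (3*n+3)) * double_sum q (n+3))) UNIV"
  proof (rule has_sum_of_reindexed[where h = "\<lambda>(i, j). (i, Suc j)"])
    show "inj (\<lambda>(i::nat, j). (i, Suc j))" by (auto simp: inj_on_def)
    fix x :: "nat \<times> nat" assume "x \<notin> range (\<lambda>(i, j). (i, Suc j))"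
    then have "snd x = 0" by (cases x; cases "snd x") auto
    then show "f1 x = 0" by (cases x) (simp add: f1_def)
  next
    have "f1 (i, Suc j) = - (q ^ (3*n+3)) * double_term q (n+3) (i, j)" for i j
    proof -
      have nz: "1 - q^3 * (q^3) ^ j \<noteq> 0" "qpoch (q^3) (q^3) j \<noteq> 0" "qpoch q q i \<noteq> 0"
        using one_minus_mult_power_nonzero[OF q3 q3] qpoch_nonzero[OF q3 q3] qpoch_nonzero[OF q q]
        by auto
      have "i + 3 * Suc j = Suc (Suc (Suc (i + 3 * j)))" by simp
      then have choose: "(i + 3 * Suc j) choose 2 = 3 * (i + 3*j) + 3 + ((i + 3*j) choose 2)"
        by (simp only: choose_2_Suc) simp
      have pow: "q ^ (3 * Suc j) = q^3 * (q^3) ^ j"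
        by (simp add: power_mult power_add)
      have exps: "n * (i + 3 * Suc j) + ((i + 3 * Suc j) choose 2) + (i choose 2)
        = (3*n+3) + ((n+3) * (i + 3*j) + ((i + 3*j) choose 2) + (i choose 2))"
        unfolding choose by (simp add: algebra_simps)
      show ?thesis
        unfolding f1_def double_term_def prod.case exps power_add[of q "3*n+3"] qpoch_Suc pow
        using nz by (simp add: divide_simps)
    qed
    then show "((\<lambda>x. f1 (case x of (i, j) \<Rightarrow> (i, Suc j))) has_sum
        (- (q ^ (3*n+3)) * double_sum q (n+3))) UNIV"
      using has_sum_cmult_right[OF double_term_has_sum[OF q, of "n+3"], of "- (q ^ (3*n+3))"]
      by (simp add: case_prod_beta)
  qed
  moreover have "(f2 has_sum (q ^ n * double_sum q (n+2))) UNIV"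
  proof (rule has_sum_of_reindexed[where h = "\<lambda>(i, j). (Suc i, j)"])
    show "inj (\<lambda>(i, j::nat). (Suc i, j))" by (auto simp: inj_on_def)
    fix x :: "nat \<times> nat" assume "x \<notin> range (\<lambda>(i, j). (Suc i, j))"
    then have "fst x = 0" by (cases x; cases "fst x") auto
    then show "f2 x = 0" by (cases x) (simp add: f2_def)
  next
    have "f2 (Suc i, j) = q ^ n * double_term q (n+2) (i, j)" for i j
    proof -
      have nz: "1 - q * q ^ i \<noteq> 0" "qpoch (q^3) (q^3) j \<noteq> 0" "qpoch q q i \<noteq> 0"
        using one_minus_mult_power_nonzero[OF q q] qpoch_nonzero[OF q3 q3] qpoch_nonzero[OF q q]
        by auto
      have choose: "(Suc i + 3 * j) choose 2 = i + 3*j + ((i + 3*j) choose 2)"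
        by (simp add: choose_2_Suc)
      have exps: "3 * j + (n * (Suc i + 3 * j) + ((Suc i + 3 * j) choose 2) + (Suc i choose 2))
        = n + ((n+2) * (i + 3*j) + ((i + 3*j) choose 2) + (i choose 2))"
        unfolding choose choose_2_Suc by (simp add: algebra_simps)
      have "f2 (Suc i, j) = (1 - q * q ^ i) * ((-1) ^ j *
          q ^ (3 * j + (n * (Suc i + 3 * j) + ((Suc i + 3 * j) choose 2) + (Suc i choose 2)))
           / (qpoch q q i * (1 - q * q ^ i) * qpoch (q^3) (q^3) j))"
        by (simp add: f2_def double_term_def qpoch_Suc power_add)
      also have "\<dots> = q ^ n * double_term q (n+2) (i, j)"
        unfolding exps power_add[of q n] double_term_def prod.case using nz by (simp add: divide_simps)
      finally show ?thesis .
    qed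
    then show "((\<lambda>x. f2 (case x of (i, j) \<Rightarrow> (Suc i, j))) has_sum (q ^ n * double_sum q (n+2))) UNIV"
      using has_sum_cmult_right[OF double_term_has_sum[OF q, of "n+2"], of "q ^ n"]
      by (simp add: case_prod_beta)
  qed
  ultimately have "((\<lambda>x. f1 x + f2 x) has_sum
      (- (q ^ (3*n+3)) * double_sum q (n+3) + q ^ n * double_sum q (n+2))) UNIV"
    by (rule has_sum_add)
  moreover have "((\<lambda>x. double_term q n x - double_term q (n+1) x) has_sum
      (double_sum q n - double_sum q (n+1))) UNIV"
    using n by (intro has_sum_minus double_term_has_sum q) auto
  moreover have "double_term q n x - double_term q (n+1) x = f1 x + f2 x" for x
  proof -
    obtain i j where x: "x = (i, j)" by (cases x)
    have "double_term q (n+1) x = q ^ (i + 3*j) * double_term q n x"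
      by (simp add: double_term_def x power_add mult_ac)
    then show ?thesis
      by (simp add: f1_def f2_def x power_add algebra_simps)
  qed
  ultimately have "double_sum q n - double_sum q (n+1) =
      - (q ^ (3*n+3)) * double_sum q (n+3) + q ^ n * double_sum q (n+2)"
    by (intro has_sum_unique[where f = "\<lambda>x. f1 x + f2 x"]) simp_all
  then show ?thesis by simp
qed

text \<open>
  The four-term recurrence factors: the defect \<open>E\<close> of the three-term recurrence satisfies
  \<open>E n = - (q ^ n) * E (n + 1)\<close>. This reflects the division of \<open>1 + z ^ 3\<close> by \<open>1 + z\<close> in the generating
  function \<open>(\<Prod>k. (1 + z * q ^ k) / (1 + z ^ 3 * q ^ (3 * k)))\<close> of the coefficients of \<open>t ^ N\<close>
  (stripped of their factor \<open>q ^ (N choose 2)\<close>).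
\<close>

lemma double_sum_three_term:
  assumes q: "norm q < 1" and n: "n \<ge> 1"
  shows "double_sum q n = (1 + q ^ n) * double_sum q (n+1) - q ^ (2*n+1) * double_sum q (n+2)"
proof -
  define E where "E n = double_sum q n - (1 + q ^ n) * double_sum q (n+1)
      + q ^ (2*n+1) * double_sum q (n+2)" for n
  have "E n = 0"
  proof (rule zero_of_damped_recurrence[OF q _ _ n])
    fix m :: nat assume m: "m \<ge> 1"
    have "E m = - (q ^ m) * E (Suc m)"
    proof -
      have triple: "3 * m = m + m + m" and idx: "m + 3 = Suc (Suc (Suc m))" by simp_all
      have pow: "q ^ (2*m+1) = q * q^m * q^m" "q ^ (2 * Suc m + 1) = q * q * q * q^m * q^m"
        "q ^ (3*m+3) = q * q * q * q^m * q^m * q^m" "q ^ Suc m = q * q ^ m"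
        unfolding triple mult_2 power_add by (simp_all add: power_add power3_eq_cube mult_ac)
      show ?thesis
        using double_sum_four_term[OF q m] unfolding E_def pow by (simp add: idx algebra_simps)
    qed
    moreover have "norm q ^ m \<le> norm q"
      using power_decreasing[of 1 m "norm q"] m q by simp
    ultimately show "norm (E m) \<le> norm q * norm (E (Suc m))"
      by (simp add: norm_mult norm_power mult_right_mono)
  next
    show "E \<longlonglongrightarrow> 0"
      unfolding E_def by (intro three_term_defect_tendsto_0 q double_sum_tendsto_1)
  qed
  then show ?thesis by (simp add: E_def algebra_simps)
qed

section \<open>A single sum with the same recurrence\<close>

text \<open>
  With \<open>t = q ^ k\<close> and a primitive cube root of unity \<open>\<omega>\<close>, this is the product of the factors
  \<open>(1 - \<omega> * t * q ^ l) * (1 - \<omega>\<^sup>2 * t * q ^ l)\<close> over all \<open>l\<close>.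
\<close>

definition cubic_quotient :: "complex \<Rightarrow> nat \<Rightarrow> complex" where
  "cubic_quotient q k = qpoch_inf (q ^ (3*k)) (q^3) / qpoch_inf (q ^ k) q"

text \<open>
  These coefficients come from the expansion, a form of the q-Chu-Vandermonde sum, of
  \<open>q ^ (a * b) / ((q; q)_a * (q; q)_b)\<close> as the sum over \<open>m\<close> of
  \<open>(-1) ^ m * q ^ (m choose 2) / ((q; q)_m * (q; q)_(a - m) * (q; q)_(b - m))\<close>.
  Inserting it into the double series over \<open>a\<close> and \<open>b\<close> that involves \<open>\<omega>\<close>, and summing over \<open>a - m\<close> and
  \<open>b - m\<close> by Euler's expansion, gives the two factors of \<open>cubic_quotient\<close>. The powers of \<open>q\<close> collected on
  the way raise the exponent \<open>m choose 2\<close> to \<open>3 * (m choose 2)\<close>.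
\<close>

definition single_coeff :: "complex \<Rightarrow> nat \<Rightarrow> complex" where
  "single_coeff q m = (-1) ^ m * q ^ (3 * (m choose 2)) / qpoch q q m"

definition single_term :: "complex \<Rightarrow> nat \<Rightarrow> nat \<Rightarrow> complex" where
  "single_term q n m = single_coeff q m * q ^ (2*n*m) * cubic_quotient q (n + m)"

definition single_sum :: "complex \<Rightarrow> nat \<Rightarrow> complex" where
  "single_sum q n = infsum (single_term q n) UNIV"

lemma cubic_quotient_step:
  assumes q: "norm q < 1" and k: "k \<ge> 1"
  shows "cubic_quotient q k = (1 + q ^ k + q ^ (2*k)) * cubic_quotient q (Suc k)"
proof -
  have "1 - q ^ 1 * q ^ (k - 1) \<noteq> 0"
    using one_minus_mult_power_nonzero[OF q q] by simp
  then have nz: "1 - q ^ k \<noteq> 0"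
    using k by (simp flip: power_Suc)
  have "qpoch_inf (q ^ k) q = (1 - q ^ k) * qpoch_inf (q ^ Suc k) q"
    using qpoch_inf_split[OF q, of "q ^ k" 1] by (simp add: qpoch_Suc[of _ _ 0, simplified] mult.commute)
  moreover have "qpoch_inf (q ^ (3*k)) (q^3) = (1 - q ^ (3*k)) * qpoch_inf (q ^ (3 * Suc k)) (q^3)"
    using qpoch_inf_split[OF norm_cube_less_1[OF q], of "q ^ (3*k)" 1]
    by (simp add: qpoch_Suc[of _ _ 0, simplified] power_add mult.commute)
  moreover have "1 - q ^ (3*k) = (1 - q ^ k) * (1 + q ^ k + q ^ (2*k))"
    unfolding mult.commute[of _ k] power_mult
    by (simp add: power2_eq_square power3_eq_cube algebra_simps)
  ultimately show ?thesis
    using nz unfolding cubic_quotient_def by (simp add: divide_simps)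
qed

lemma cubic_quotient_tendsto_1:
  assumes q: "norm q < 1"
  shows "cubic_quotient q \<longlonglongrightarrow> 1"
proof -
  note q3 = norm_cube_less_1[OF q]
  have "(\<lambda>n. qpoch_inf (q^3 * (q^3) ^ n) (q^3) / qpoch_inf (q * q ^ n) q) \<longlonglongrightarrow> 1 / 1"
    by (intro tendsto_divide qpoch_inf_tail_tendsto_1 q q3) simp
  then have "(\<lambda>n. cubic_quotient q (Suc n)) \<longlonglongrightarrow> 1"
    by (simp add: cubic_quotient_def power_mult power_add)
  then show ?thesis by (rule LIMSEQ_imp_Suc)
qed

lemma single_coeff_step:
  assumes q: "norm q < 1"
  shows "(1 - q ^ Suc m) * single_coeff q (Suc m) = - (q ^ (3*m)) * single_coeff q m"
proof -
  have "1 - q * q ^ m \<noteq> 0" "qpoch q q m \<noteq> 0"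
    using one_minus_mult_power_nonzero[OF q q] qpoch_nonzero[OF q q] by auto
  then show ?thesis
    by (simp add: single_coeff_def qpoch_Suc choose_2_Suc divide_simps power_add add_mult_distrib2)
qed

lemma single_term_dominated:
  assumes q: "norm q < 1"
  obtains M where "M summable_on UNIV" "\<And>n x. n \<ge> 1 \<Longrightarrow> norm (single_term q n x) \<le> M x"
proof -
  obtain C where C: "C > 0" "\<And>i. norm (1 / qpoch q q i) \<le> C"
    using inverse_qpoch_bounded[OF q q] by blast
  have "Bseq (cubic_quotient q)"
    using cubic_quotient_tendsto_1[OF q] convergentI convergent_imp_Bseq by blast
  then obtain K where K: "K > 0" "\<And>k. norm (cubic_quotient q k) \<le> K"
    unfolding Bseq_def by blast
  show ?thesis
  proof (rule that)
    show "(\<lambda>m. (C * K) * norm q ^ m) summable_on UNIV"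
      using q by (intro geometric_summable_on) auto
    fix n m :: nat assume "n \<ge> 1"
    define k where "k = 3 * (m choose 2) + 2*n*m"
    have "1 * m \<le> (2 * n) * m"
      using \<open>n \<ge> 1\<close> by (intro mult_right_mono) auto
    then have "m \<le> 2 * n * m" by simp
    then have "m \<le> k" unfolding k_def by linarith
    then have "norm q ^ k \<le> norm q ^ m"
      using q by (intro power_decreasing) auto
    have "norm (single_term q n m) =
        norm (1 / qpoch q q m) * norm (cubic_quotient q (n + m)) * norm q ^ k"
      by (simp add: single_term_def single_coeff_def k_def norm_mult norm_divide norm_power power_add)
    also have "\<dots> \<le> C * K * norm q ^ m"
      using \<open>norm q ^ k \<le> _\<close> C K by (intro mult_mono) auto
    finally show "norm (single_term q n m) \<le> (C * K) * norm q ^ m" .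
  qed
qed

lemma single_term_has_sum:
  assumes "norm q < 1" "n \<ge> 1"
  shows "(single_term q n has_sum single_sum q n) UNIV"
proof -
  obtain M where "M summable_on UNIV" "\<And>x. norm (single_term q n x) \<le> M x"
    using single_term_dominated[OF assms(1)] assms(2) by metis
  then show ?thesis
    unfolding single_sum_def by (intro has_sum_infsum_of_dominated)
qed

lemma single_sum_tendsto_1:
  assumes q: "norm q < 1"
  shows "single_sum q \<longlonglongrightarrow> 1"
proof -
  note lim = cubic_quotient_tendsto_1[OF q]
  obtain M where M: "M summable_on UNIV" "\<And>n x. n \<ge> 1 \<Longrightarrow> norm (single_term q n x) \<le> M x"
    using single_term_dominated[OF q] by blast
  have "(\<lambda>n. infsum (single_term q (Suc n)) UNIV) \<longlonglongrightarrow> 1"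
  proof (rule infsum_tendsto_1_of_dominated[where a = 0])
    show "(\<lambda>n. single_term q (Suc n) 0) \<longlonglongrightarrow> 1"
      using LIMSEQ_Suc[OF lim] by (simp add: single_term_def single_coeff_def)
    fix m :: nat assume "m \<noteq> 0"
    then have "(\<lambda>n. single_coeff q m * q ^ (Suc n * (2*m)) * cubic_quotient q (n + Suc m))
        \<longlonglongrightarrow> single_coeff q m * 0 * 1"
      by (intro tendsto_mult tendsto_const power_tendsto_0_mult q LIMSEQ_ignore_initial_segment lim) auto
    then show "(\<lambda>n. single_term q (Suc n) m) \<longlonglongrightarrow> 0"
      by (simp add: single_term_def mult_ac)
  qed (use M in auto)
  then show ?thesis
    unfolding single_sum_def[symmetric] by (rule LIMSEQ_imp_Suc)
qed

text \<open>
  The defect \<open>D\<close> of the recurrence is again damped, \<open>D n = q ^ (2 * n) * D (n + 1)\<close>. To compare the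
  terms, all cubic quotients in \<open>D n\<close> are brought to the index \<open>n + m + 1\<close>: those of \<open>single_sum q n\<close> by
  \<open>cubic_quotient_step\<close>, those of \<open>single_sum q (n + 2)\<close> by shifting \<open>m\<close>. This leaves the weights \<open>w n m\<close>
  with the factors \<open>X n m\<close>. Shifting \<open>m\<close> in the part of \<open>X\<close> that contains \<open>1 - q ^ m\<close> and applying
  \<open>cubic_quotient_step\<close> to the rest gives the same expression with \<open>n + 1\<close> in place of \<open>n\<close>.
\<close>

lemma single_sum_three_term:
  assumes q: "norm q < 1" and n: "n \<ge> 1"
  shows "single_sum q n = (1 + q ^ n) * single_sum q (n+1) - q ^ (2*n+1) * single_sum q (n+2)"
proof -
  define D where "D n = single_sum q n - (1 + q ^ n) * single_sum q (n+1)
      + q ^ (2*n+1) * single_sum q (n+2)" for n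
  define w where "w n m = single_coeff q m * q ^ (2*n*m) * cubic_quotient q (n + m + 1)" for n m
  define X where "X n m = (1 - q ^ m) * (1 + q ^ (n + m)) + q ^ (2*n + 2*m)" for n m :: nat
  have w_Suc: "(1 - q ^ Suc m) * w n (Suc m) = - (q ^ (3*m + 2*n)) * w' "
    if "w' = single_coeff q m * q ^ (2*n*m) * cubic_quotient q (n + m + 2)" for n m w'
  proof -
    have "(1 - q ^ Suc m) * w n (Suc m)
      = ((1 - q ^ Suc m) * single_coeff q (Suc m)) * q ^ (2*n*m + 2*n) * cubic_quotient q (n + m + 2)"
      by (simp add: w_def algebra_simps)
    then show ?thesis
      unfolding single_coeff_step[OF q] that by (simp add: power_add mult_ac)
  qed
  have D_sum: "((\<lambda>m. X n m * w n m) has_sum D n) UNIV" if n: "n \<ge> 1" for n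
  proof -
    \<comment> \<open>Shifted down in \<open>m\<close>, the terms of \<open>single_sum q (n + 2)\<close> carry the same \<open>w n m\<close> as those of
      \<open>single_sum q n\<close>; the factor \<open>1 - q ^ m\<close> comes from \<open>single_coeff_step\<close>.\<close>
    have "((\<lambda>m. - (q ^ m) * (1 - q ^ m) * w n m) has_sum q ^ (2*n+1) * single_sum q (n+2)) UNIV"
    proof (rule has_sum_shift_nat)
      have "- (q ^ Suc m) * (1 - q ^ Suc m) * w n (Suc m) = q ^ (2*n+1) * single_term q (n+2) m" for m
        unfolding mult.assoc w_Suc[OF refl] single_term_def
        by (simp add: power_add algebra_simps numeral_eq_Suc power_mult_distrib)
      then show "((\<lambda>m. - (q ^ Suc m) * (1 - q ^ Suc m) * w n (Suc m)) has_sum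
          q ^ (2*n+1) * single_sum q (n+2)) UNIV"
        by (simp only:) (intro has_sum_cmult_right single_term_has_sum q, simp)
    qed simp
    then have "((\<lambda>m. single_term q n m - (1 + q ^ n) * single_term q (n+1) m
        + (- (q ^ m) * (1 - q ^ m) * w n m)) has_sum D n) UNIV"
      unfolding D_def using n
      by (intro has_sum_add has_sum_minus has_sum_cmult_right single_term_has_sum q) auto
    moreover have "single_term q n m - (1 + q ^ n) * single_term q (n+1) m
        + (- (q ^ m) * (1 - q ^ m) * w n m) = X n m * w n m" for m
    proof -
      have "single_term q n m = (1 + q ^ (n + m) + q ^ (2*n + 2*m)) * w n m"
        using cubic_quotient_step[OF q, of "n + m"] n by (simp add: single_term_def w_def mult_ac)
      moreover have "single_term q (n+1) m = q ^ (2*m) * w n m"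
        by (simp add: single_term_def w_def power_add algebra_simps)
      ultimately show ?thesis
        by (simp only: X_def mult_2 power_add) (simp add: algebra_simps)
    qed
    ultimately show ?thesis by simp
  qed
  have D_step: "D n = q ^ (2*n) * D (n+1)" if n: "n \<ge> 1" for n
  proof -
    define V where "V = q ^ (2*n) * single_sum q (n+1)"
    have v: "((\<lambda>m. q ^ (2*n + 2*m) * w n m) has_sum V) UNIV"
    proof -
      have "q ^ (2*n + 2*m) * w n m = q ^ (2*n) * single_term q (n+1) m" for m
        by (simp add: single_term_def w_def power_add algebra_simps)
      then show ?thesis
        unfolding V_def by (simp only:) (intro has_sum_cmult_right single_term_has_sum q, simp)
    qed
    have u: "((\<lambda>m. (1 + q ^ (n + m)) * ((1 - q ^ m) * w n m)) has_sum (q ^ (2*n) * D (n+1) - V)) UNIV"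
    proof (rule has_sum_shift_nat)
      have "(1 + q ^ (n + Suc m)) * ((1 - q ^ Suc m) * w n (Suc m))
        = q ^ (2*n) * (X (n+1) m * w (n+1) m) - q ^ (2*n + 2*m) * w n m" for m
      proof -
        define y where "y = single_coeff q m * q ^ (2*n*m) * cubic_quotient q (n + m + 2)"
        have "w n m = (1 + q ^ (n + m + 1) + q ^ (2*n + 2*m + 2)) * y"
          using cubic_quotient_step[OF q, of "n + m + 1"] by (simp add: w_def y_def mult_ac)
        moreover have "w (n+1) m = q ^ (2*m) * y"
          by (simp add: w_def y_def power_add algebra_simps)
        moreover have "3 * m + 2 * n = m + m + m + n + n" by simp
        ultimately show ?thesis
          unfolding w_Suc[OF y_def]
          by (simp only: X_def mult_2 power_add) (simp add: algebra_simps power2_eq_square)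
      qed
      then show "((\<lambda>m. (1 + q ^ (n + Suc m)) * ((1 - q ^ Suc m) * w n (Suc m))) has_sum
          (q ^ (2*n) * D (n+1) - V)) UNIV"
        by (simp only:) (intro has_sum_minus has_sum_cmult_right D_sum v, simp)
    qed simp
    have "X n m * w n m = (1 + q ^ (n + m)) * ((1 - q ^ m) * w n m) + q ^ (2*n + 2*m) * w n m" for m
      by (simp add: X_def algebra_simps)
    then have "((\<lambda>m. X n m * w n m) has_sum (q ^ (2*n) * D (n+1))) UNIV"
      using has_sum_add[OF u v] by simp
    with D_sum[OF n] show ?thesis by (rule has_sum_unique)
  qed
  have "D n = 0"
  proof (rule zero_of_damped_recurrence[OF q _ _ n])
    fix m :: nat assume m: "m \<ge> 1"
    then have "norm q ^ (2*m) \<le> norm q"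
      using power_decreasing[of 1 "2*m" "norm q"] q by simp
    then show "norm (D m) \<le> norm q * norm (D (Suc m))"
      using D_step[OF m] by (simp add: norm_mult norm_power mult_right_mono)
  next
    show "D \<longlonglongrightarrow> 0"
      unfolding D_def by (intro three_term_defect_tendsto_0 q single_sum_tendsto_1)
  qed
  then show ?thesis by (simp add: D_def algebra_simps)
qed

section \<open>Evaluation at \<open>t = q\<close>\<close>

text \<open>
  At \<open>t = q\<close> the ratio of \<open>cubic_quotient q (m + 1)\<close> to \<open>cubic_quotient q 1\<close> turns the denominator \<open>qpoch q q m\<close> into
  \<open>qpoch (q^3) (q^3) m\<close>, so the series becomes Euler's expansion in base \<open>q ^ 3\<close> at \<open>q\<^sup>2\<close>. Of the three
  residue classes modulo 3 in \<open>qpoch_inf q q\<close>, those of 0 and 2 cancel.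
\<close>

lemma single_sum_1:
  assumes q: "norm q < 1"
  shows "single_sum q 1 = 1 / qpoch_inf q (q^3)"
proof -
  note q3 = norm_cube_less_1[OF q]
  have q2: "norm (q ^ 2) < 1" using q by (simp add: norm_power power_less_one_iff)
  have nz: "qpoch_inf q q \<noteq> 0" "qpoch_inf q (q^3) \<noteq> 0" "qpoch_inf (q^3) (q^3) \<noteq> 0"
    "qpoch_inf (q^2) (q^3) \<noteq> 0"
    using q q2 q3 by (simp_all add: qpoch_inf_nonzero)
  define A where "A = cubic_quotient q 1"
  have expand: "single_term q 1 m
      = A * ((-1) ^ m * (q^3) ^ (m choose 2) * (q^2) ^ m / qpoch (q^3) (q^3) m)" for m
  proof -
    have "qpoch_inf q q = qpoch q q m * qpoch_inf (q ^ (1 + m)) q"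
      using qpoch_inf_split[OF q, of q m] by simp
    moreover have "qpoch_inf (q^3) (q^3) = qpoch (q^3) (q^3) m * qpoch_inf (q ^ (3 * (1 + m))) (q^3)"
      using qpoch_inf_split[OF q3, of "q^3" m] by (simp add: power_add power_mult)
    ultimately have "A * qpoch q q m / qpoch (q^3) (q^3) m = cubic_quotient q (1 + m)"
      using nz qpoch_nonzero[OF q q, of m] qpoch_nonzero[OF q3 q3, of m]
      by (simp add: A_def cubic_quotient_def divide_simps)
    then have "single_term q 1 m = single_coeff q m * q ^ (2 * m)
        * (A * qpoch q q m / qpoch (q^3) (q^3) m)"
      by (simp add: single_term_def)
    then show ?thesis
      using qpoch_nonzero[OF q q, of m] by (simp add: single_coeff_def power_mult)
  qed
  have "(single_term q 1 has_sum (A * qpoch_inf (q^2) (q^3))) UNIV"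
    unfolding expand by (intro has_sum_cmult_right euler_qpoch_inf q2 q3)
  then have "single_sum q 1 = A * qpoch_inf (q^2) (q^3)"
    unfolding single_sum_def by (rule infsumI)
  also have "\<dots> = 1 / qpoch_inf q (q^3)"
  proof -
    have "q * q = q ^ 2" "q * q ^ 2 = q ^ 3"
      by (simp_all add: power2_eq_square power3_eq_cube)
    then show ?thesis
      using qpoch_inf_trisect[OF q, of q] nz by (simp add: A_def cubic_quotient_def divide_simps)
  qed
  finally show ?thesis .
qed

theorem theorem1p2:
  fixes q :: complex
  assumes "norm q < 1"
  shows "((\<lambda>(i::nat, j::nat).
            (-1) ^ j * q ^ (i^2 + 3*i*j + (3*j*(3*j+1)) div 2)
              / (qpoch q q i * qpoch (q^3) (q^3) j))
          has_sum (1 / qpoch_inf q (q^3))) UNIV"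
proof -
  define d where "d n = double_sum q n - single_sum q n" for n
  have "d 1 = 0"
  proof (rule zero_of_three_term_recurrence[OF assms])
    show "d n = (1 + q ^ n) * d (n + 1) - q ^ (2*n+1) * d (n + 2)" if "n \<ge> 1" for n
      unfolding d_def double_sum_three_term[OF assms that] single_sum_three_term[OF assms that]
      by (simp add: algebra_simps)
    show "d \<longlonglongrightarrow> 0"
      unfolding d_def
      using tendsto_diff[OF double_sum_tendsto_1[OF assms] single_sum_tendsto_1[OF assms]] by simp
  qed simp
  then have "(double_term q 1 has_sum (1 / qpoch_inf q (q^3))) UNIV"
    using double_term_has_sum[OF assms, of 1] single_sum_1[OF assms] by (simp add: d_def)
  then show ?thesis
    by (simp only: exponent_eq double_term_def mult_1)
qed

end
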